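(* $\Pi^1_1\text{-}\mathsf{LNP}$ is ${\uparrow}D_\omega(\Sigma^0_1/\Pi^1_1)$-complete.
   Context: $\delta_{\Pi^1_1}:\omega^\omega\to\boldsymbol{\Pi}^1_1(\omega)$ is the total representation of the $\boldsymbol{\Pi}^1_1$ subsets of $\omega$: $\delta_{\Pi^1_1}(e^\frown p)$ is the $e$-th $\Pi^1_1(p)$ subset of $\omega$ (standard effective enumeration). $\Pi^1_1\text{-}\mathsf{LNP}:\subseteq\boldsymbol{\Pi}^1_1(\omega)\to\omega$ is the partial function with $\Pi^1_1\text{-}\mathsf{LNP}(A)=\min A$ if $A\ne\emptyset$, undefined if $A=\emptyset$. For an increasing sequence $(A_n)_{n<\omega}$ of subsets of $\omega^\omega$ and a sequence $(f_n)_{n<\omega}$ of partial functions $f_n:\subseteq\omega^\omega\to\omega$, the partial function ${\uparrow}\mathbb{D}_{n<\omega}[f_n/A_n]$ sends $x$ to $f_m(x)$ if $m=\min\{n<\omega:x\in A_n\}$ exists, and is undefined at $x$ otherwise. ${\uparrow}D_\omega(\Sigma^0_1/\Pi^1_1)$ is the class of all partial functions ${\uparrow}\mathbb{D}_{n<\omega}[f_n/A_n]$ with $(A_n)$ a uniformly $\Pi^1_1$ increasing sequence of subsets of $\omega^\omega$ and $(f_n)$ a computable sequence of (partial) computable functions. Weihrauch reducibility: for partial (multivalued) functions $f,g$ between represented spaces, $f\le_{\mathsf W}g$ if there are partial computable $h,k$ on $\omega^\omega$ such that for every name $\mathtt{x}$ of some $x\in{\rm dom}(f)$, $h(\mathtt{x})$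 is a name of some $x^\ast\in{\rm dom}(g)$, and whenever $\mathtt{y}$ is a name of an element of $g(x^\ast)$, $k(\mathtt{x},\mathtt{y})$ is a name of an element of $f(x)$. ($\omega$ and $\omega^\omega$ carry their standard representations.) For a class $\mathcal{F}$ of partial functions $\omega^\omega\to\omega$ and a represented space $(X,\delta_X)$, a partial function $f:\subseteq X\to\omega$ is $\mathcal{F}$-complete if $f\circ\delta_X\in\mathcal{F}$ and every $g\in\mathcal{F}$ satisfies $g\le_{\mathsf W}f$. *)

theory Defs
  imports Main "HOL-Library.Nat_Bijection"
begin

section \<open>Partial recursive functions relative to a point of Baire space\<close>

text \<open>
  Kleene's schemata, in unary form: tuples of arguments are coded by the bijective
  pairing \<^const>\<open>prod_encode\<close>.
\<close>

type_synonym baire = "nat \<Rightarrow> nat"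

datatype code =
    CZero
  | CSucc
  | CFst
  | CSnd
  | COracle
  | CPair code code
  | CComp code code
  | CPrec code code
  | CMu code

inductive eval :: "baire \<Rightarrow> code \<Rightarrow> nat \<Rightarrow> nat \<Rightarrow> bool" for p :: baire where
  zero: "eval p CZero x 0"
| succ: "eval p CSucc x (Suc x)"
| fst: "eval p CFst x (fst (prod_decode x))"
| snd: "eval p CSnd x (snd (prod_decode x))"
| query: "eval p COracle x (p x)"
| pair: "eval p a x u \<Longrightarrow> eval p b x v \<Longrightarrow> eval p (CPair a b) x (prod_encode (u, v))"
| comp: "eval p b x u \<Longrightarrow> eval p a u v \<Longrightarrow> eval p (CComp a b) x v"
| prec_0: "eval p a x v \<Longrightarrow> eval p (CPrec a b) (prod_encode (x, 0)) v"
| prec_Suc: "eval p (CPrec a b) (prod_encode (x, n)) u \<Longrightarrow>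
    eval p b (prod_encode (x, prod_encode (n, u))) v \<Longrightarrow>
    eval p (CPrec a b) (prod_encode (x, Suc n)) v"
| mu: "eval p a (prod_encode (x, n)) 0 \<Longrightarrow>
    (\<And>i. i < n \<Longrightarrow> \<exists>v. eval p a (prod_encode (x, i)) (Suc v)) \<Longrightarrow>
    eval p (CMu a) x n"

inductive_cases eval_zeroE: "eval p CZero x v"
inductive_cases eval_succE: "eval p CSucc x v"
inductive_cases eval_fstE: "eval p CFst x v"
inductive_cases eval_sndE: "eval p CSnd x v"
inductive_cases eval_oracleE: "eval p COracle x v"
inductive_cases eval_pairE: "eval p (CPair a b) x v"
inductive_cases eval_compE: "eval p (CComp a b) x v"
inductive_cases eval_precE: "eval p (CPrec a b) x v"
inductive_cases eval_muE: "eval p (CMu a) x v"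

lemma eval_det: "eval p c x v \<Longrightarrow> eval p c x w \<Longrightarrow> v = w"
proof (induction arbitrary: w rule: eval.induct)
  case (mu a x n)
  from mu.prems obtain z: "eval p a (prod_encode (x, w)) 0"
    and l: "\<And>i. i < w \<Longrightarrow> \<exists>v. eval p a (prod_encode (x, i)) (Suc v)"
    by (auto elim: eval_muE)
  show ?case
  proof (rule linorder_cases[of n w])
    assume "n < w"
    with l mu.IH(1) show ?thesis by blast
  next
    assume "w < n"
    with z mu.IH(2) show ?thesis by blast
  qed
next
  case (pair a x u b v)
  then show ?case by (metis eval_pairE)
next
  case (comp b x u a v)
  then show ?case by (metis eval_compE)
next
  case (prec_0 a x v b)
  from prec_0.prems show ?case
    by (rule eval_precE) (use prec_0.IH in auto)
next
  case (prec_Suc a b x n u v)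
  from prec_Suc.prems show ?case
    by (rule eval_precE) (use prec_Suc.IH in auto)
qed (auto elim: eval_zeroE eval_succE eval_fstE eval_sndE eval_oracleE)

primrec encode :: "code \<Rightarrow> nat" where
  "encode CZero = 0"
| "encode CSucc = 1"
| "encode CFst = 2"
| "encode CSnd = 3"
| "encode COracle = 4"
| "encode (CPair a b) = 5 + 4 * prod_encode (encode a, encode b)"
| "encode (CComp a b) = 6 + 4 * prod_encode (encode a, encode b)"
| "encode (CPrec a b) = 7 + 4 * prod_encode (encode a, encode b)"
| "encode (CMu a) = 8 + 4 * encode a"

lemma encode_eqs:
  fixes i j :: nat
  shows "5 + 4 * i \<noteq> 6 + 4 * j" "5 + 4 * i \<noteq> 7 + 4 * j" "5 + 4 * i \<noteq> 8 + 4 * j"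
    "6 + 4 * i \<noteq> 7 + 4 * j" "6 + 4 * i \<noteq> 8 + 4 * j" "7 + 4 * i \<noteq> 8 + 4 * j"
  by presburger+

lemma inj_encode: "inj encode"
proof (rule injI)
  show "encode c = encode d \<Longrightarrow> c = d" for c d
  proof (induction c arbitrary: d)
    case (CPair a b)
    then show ?case
      by (cases d) (simp_all only: encode.simps encode_eqs encode_eqs[symmetric], simp_all)
  next
    case (CComp a b)
    then show ?case
      by (cases d) (simp_all only: encode.simps encode_eqs encode_eqs[symmetric], simp_all)
  next
    case (CPrec a b)
    then show ?case
      by (cases d) (simp_all only: encode.simps encode_eqs encode_eqs[symmetric], simp_all)
  next
    case (CMu a)
    then show ?case
      by (cases d) (simp_all only: encode.simps encode_eqs encode_eqs[symmetric], simp_all)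
  qed (case_tac d; simp)+
qed

lemma surj_encode: "surj encode"
proof -
  have "\<exists>c. encode c = n" for n
  proof (induction n rule: less_induct)
    case (less n)
    show ?case
    proof (cases "n < 5")
      case True
      then consider "n = 0" | "n = 1" | "n = 2" | "n = 3" | "n = 4" by linarith
      then show ?thesis by cases (metis encode.simps)+
    next
      case False
      define m where "m = (n - 5) div 4"
      define r where "r = (n - 5) mod 4"
      obtain i j where ij: "m = prod_encode (i, j)"
        by (metis prod_decode_inverse surj_pair)
      have n: "n = 5 + 4 * m + r" "r < 4"
        using False by (auto simp: m_def r_def)
      have "i \<le> m" "j \<le> m"
        unfolding ij by (rule le_prod_encode_1, rule le_prod_encode_2)
      with n have "i < n" "j < n" "m < n" by auto
      with less.IH obtain a b c where abc: "encode a = i" "encode b = j" "encode c = m"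
        by meson
      from n(2) consider "r = 0" | "r = 1" | "r = 2" | "r = 3" by linarith
      then show ?thesis
      proof cases
        case 1 with n abc ij have "encode (CPair a b) = n" by simp
        then show ?thesis ..
      next
        case 2 with n abc ij have "encode (CComp a b) = n" by simp
        then show ?thesis ..
      next
        case 3 with n abc ij have "encode (CPrec a b) = n" by simp
        then show ?thesis ..
      next
        case 4 with n abc have "encode (CMu c) = n" by simp
        then show ?thesis ..
      qed
    qed
  qed
  then show ?thesis by (metis surjI)
qed

definition decode :: "nat \<Rightarrow> code" where
  "decode = inv encode"

text \<open>
  \<open>phi e p n\<close> is the value at \<open>n\<close> of the \<open>e\<close>-th partial recursive function relative to \<open>p\<close>.
\<close>

definition phi :: "nat \<Rightarrow> baire \<Rightarrow> nat \<Rightarrow> nat option" where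
  "phi e p n = (if \<exists>v. eval p (decode e) n v then Some (THE v. eval p (decode e) n v) else None)"


lemma phi_eq_Some: "phi e p n = Some v \<longleftrightarrow> eval p (decode e) n v"
proof -
  have "(THE v. eval p (decode e) n v) = v" if "eval p (decode e) n v" for v
    using that by (rule the_equality) (rule eval_det[OF _ that])
  then show ?thesis by (auto simp: phi_def)
qed

lemma decode_encode [simp]: "decode (encode c) = c"
  by (simp add: decode_def inj_encode)

section \<open>Computability on Baire space\<close>

text \<open>
  Partial computable functions have their natural domain, i.e. exactly the set of inputs on
  which the computation succeeds.  A sequence of partial functions into the natural numbers is
  computable if it is partial computable as a function of the index and the argument.
\<close>

definition computable_baire :: "(baire \<Rightarrow> baire option) \<Rightarrow> bool" where
  "computable_baire F \<longleftrightarrow>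
     (\<exists>e. \<forall>x. F x = (if \<forall>n. phi e x n \<noteq> None then Some (\<lambda>n. the (phi e x n)) else None))"

definition computable_seq :: "(nat \<Rightarrow> baire \<Rightarrow> nat option) \<Rightarrow> bool" where
  "computable_seq f \<longleftrightarrow> (\<exists>e. \<forall>n x. f n x = phi e x n)"

definition join :: "baire \<Rightarrow> baire \<Rightarrow> baire" where
  "join p q n = (if even n then p (n div 2) else q (n div 2))"


section \<open>\<Pi>-1-1 sets\<close>

text \<open>
  \<open>Sigma01 e\<close> is the \<open>e\<close>-th effectively open subset of the product of the natural numbers with
  Baire space; prefixing a universal function quantifier yields the standard enumeration
  of the \<open>\<Pi>\<close>-1-1 sets relative to \<open>p\<close>.
\<close>

definition Sigma01 :: "nat \<Rightarrow> (nat \<times> baire) set" where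
  "Sigma01 e = {(n, x). phi e x n \<noteq> None}"

definition Pi11 :: "nat \<Rightarrow> baire \<Rightarrow> nat set" where
  "Pi11 e p = {n. \<forall>g. (n, join p g) \<in> Sigma01 e}"

definition uniformly_Pi11 :: "(nat \<Rightarrow> baire set) \<Rightarrow> bool" where
  "uniformly_Pi11 A \<longleftrightarrow> (\<exists>e. \<forall>n. A n = {x. n \<in> Pi11 e x})"


section \<open>Representations and Weihrauch reducibility\<close>

text \<open>
  A represented space is given by its representation, a partial map from Baire space
  whose range is the underlying set of the space.
\<close>

type_synonym 'a representation = "baire \<Rightarrow> 'a option"

definition rep_nat :: "nat representation" where
  "rep_nat p = Some (p 0)"

definition rep_baire :: "baire representation" where
  "rep_baire p = Some p"

definition rep_Pi11 :: "nat set representation" where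
  "rep_Pi11 p = Some (Pi11 (p 0) (\<lambda>n. p (Suc n)))"

text \<open>
  Multivalued functions are set-valued; the domain consists of the points with
  nonempty value.
\<close>

definition weihrauch_le ::
    "'a representation \<Rightarrow> 'b representation \<Rightarrow> ('a \<Rightarrow> 'b set) \<Rightarrow>
     'c representation \<Rightarrow> 'd representation \<Rightarrow> ('c \<Rightarrow> 'd set) \<Rightarrow> bool" where
  "weihrauch_le rX rY f rU rV g \<longleftrightarrow>
     (\<exists>h k. computable_baire h \<and> computable_baire k \<and>
       (\<forall>p x. rX p = Some x \<and> f x \<noteq> {} \<longrightarrow>
         (\<exists>q u. h p = Some q \<and> rU q = Some u \<and> g u \<noteq> {} \<and>
           (\<forall>r v. rV r = Some v \<and> v \<in> g u \<longrightarrow>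
             (\<exists>s y. k (join p r) = Some s \<and> rY s = Some y \<and> y \<in> f x)))))"

definition complete_for ::
    "(baire \<Rightarrow> nat option) set \<Rightarrow> 'a representation \<Rightarrow> ('a \<Rightarrow> nat option) \<Rightarrow> bool" where
  "complete_for \<F> rX f \<longleftrightarrow>
     f \<circ>\<^sub>m rX \<in> \<F> \<and>
     (\<forall>g\<in>\<F>. weihrauch_le rep_baire rep_nat (\<lambda>x. set_option (g x))
                         rX rep_nat (\<lambda>x. set_option (f x)))"


section \<open>The class of increasing differences and the least number principle\<close>

definition up_diff ::
    "(nat \<Rightarrow> baire \<Rightarrow> nat option) \<Rightarrow> (nat \<Rightarrow> baire set) \<Rightarrow> baire \<Rightarrow> nat option" where
  "up_diff f A x = (if \<exists>n. x \<in> A n then f (LEAST n. x \<in> A n) x else None)"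

definition up_D_omega :: "(baire \<Rightarrow> nat option) set" where
  "up_D_omega = {up_diff f A | f A. mono A \<and> uniformly_Pi11 A \<and> computable_seq f}"

lemma rep_Pi11_surj: "\<exists>p. rep_Pi11 p = Some A"
proof -
  define idc where "idc = CPair CFst CSnd"
  define ss where "ss = CComp CSucc (CComp CSucc (CComp CSnd CSnd))"
  define dbl where "dbl = CComp (CPrec CZero ss) (CPair CZero idc)"
  define a where "a = CComp COracle (CComp dbl CFst)"
  define q :: baire where "q n = (if n \<in> A then 0 else 1)" for n
  have idc: "eval x idc n n" for x n
    using eval.pair[OF eval.fst eval.snd, of x n] by (simp add: idc_def)
  have ss: "eval x ss (prod_encode (m, prod_encode (n, u))) (Suc (Suc u))" for x m n u
    unfolding ss_def
    by (rule eval.comp[OF eval.comp[OF eval.comp[OF eval.snd eval.snd] eval.succ] eval.succ,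
          of x "prod_encode (m, prod_encode (n, u))", simplified])
  have rec: "eval x (CPrec CZero ss) (prod_encode (0, n)) (2 * n)" for x n
  proof (induction n)
    case 0 show ?case using eval.prec_0[OF eval.zero] by simp
  next
    case (Suc n) from eval.prec_Suc[OF Suc ss] show ?case by simp
  qed
  have dbl: "eval x dbl n (2 * n)" for x n
    unfolding dbl_def by (rule eval.comp[OF eval.pair[OF eval.zero idc] rec])
  have a: "eval x a (prod_encode (n, i)) (x (2 * n))" for x n i
    unfolding a_def
    using eval.comp[OF eval.comp[OF eval.fst dbl] eval.query, of x "prod_encode (n, i)"]
    by simp
  have mu: "(\<exists>v. eval x (CMu a) n v) \<longleftrightarrow> x (2 * n) = 0" for x n
  proof
    assume "\<exists>v. eval x (CMu a) n v"
    then obtain v where "eval x a (prod_encode (n, v)) 0" by (auto elim: eval_muE)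
    with a show "x (2 * n) = 0" by (metis eval_det)
  next
    assume "x (2 * n) = 0"
    with a[of x n 0] have "eval x (CMu a) n 0" by (intro eval.mu) auto
    then show "\<exists>v. eval x (CMu a) n v" ..
  qed
  have "Pi11 (encode (CMu a)) q = A"
    by (auto simp: Pi11_def Sigma01_def phi_eq_Some mu join_def q_def simp del: encode.simps)
  then have "rep_Pi11 (case_nat (encode (CMu a)) q) = Some A"
    by (simp add: rep_Pi11_def)
  then show ?thesis by (rule exI[where x = "case_nat (encode (CMu a)) q"])
qed

text \<open>
  Every set of natural numbers is boldface \<open>\<Pi>\<close>-1-1 (see \<open>rep_Pi11_surj\<close>), so the type
  \<^typ>\<open>nat set\<close> is the space of boldface \<open>\<Pi>\<close>-1-1 subsets of the natural numbers.
\<close>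

definition Pi11_LNP :: "nat set \<Rightarrow> nat option" where
  "Pi11_LNP A = (if A \<noteq> {} then Some (LEAST n. n \<in> A) else None)"

end

theory Submission
  imports Defs
begin

text \<open>
  Hardness is immediate: if \<open>A\<close> has index \<open>e\<close>, then \<open>e\<close> followed by \<open>x\<close> is a name of
  \<open>{n. x \<in> A n}\<close>.  For membership take \<open>A n\<close> to be the set of names of sets having an element
  \<open>\<le> n\<close>.  Its complement requires that, for each \<open>m \<le> n\<close>, the computation on \<open>m\<close> diverges for
  some choice of the function variable.  No universal machine is needed to see that this is
  \<open>\<Sigma>\<close>-1-1: divergence is witnessed by a table that lists, for all codes and
  inputs, either a value or the claim of divergence, and that satisfies Kleene's schemata locally.
  Such a table can only err by assigning values to diverging computations, so an entry claiming
  divergence is right.  The table is absorbed into the function quantifier, and a single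
  unbounded search looks for a local inconsistency.
\<close>

section \<open>Total functions computable relative to an oracle\<close>

definition oracle_computable :: "(baire \<Rightarrow> nat \<Rightarrow> nat) \<Rightarrow> bool" where
  "oracle_computable F \<longleftrightarrow> (\<exists>c. \<forall>p z. eval p c z (F p z))"

lemma oracle_computable_compose:
  assumes "oracle_computable F" "oracle_computable f"
  shows "oracle_computable (\<lambda>p z. F p (f p z))"
  using assms unfolding oracle_computable_def by (meson eval.comp)

lemma oracle_computable_pair:
  assumes "oracle_computable f" "oracle_computable g"
  shows "oracle_computable (\<lambda>p z. prod_encode (f p z, g p z))"
  using assms unfolding oracle_computable_def by (meson eval.pair)

lemma oracle_computable_id: "oracle_computable (\<lambda>p z. z)"
  unfolding oracle_computable_def
  by (rule exI[of _ "CPair CFst CSnd"])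
    (metis eval.fst eval.snd eval.pair prod.collapse prod_decode_inverse)

lemma oracle_computable_Suc:
  "oracle_computable f \<Longrightarrow> oracle_computable (\<lambda>p z. Suc (f p z))"
  unfolding oracle_computable_def by (meson eval.comp eval.succ)

lemma oracle_computable_fst:
  "oracle_computable f \<Longrightarrow> oracle_computable (\<lambda>p z. fst (prod_decode (f p z)))"
  unfolding oracle_computable_def by (meson eval.comp eval.fst)

lemma oracle_computable_snd:
  "oracle_computable f \<Longrightarrow> oracle_computable (\<lambda>p z. snd (prod_decode (f p z)))"
  unfolding oracle_computable_def by (meson eval.comp eval.snd)

lemma oracle_computable_query:
  "oracle_computable f \<Longrightarrow> oracle_computable (\<lambda>p z. p (f p z))"
  unfolding oracle_computable_def by (meson eval.comp eval.query)

lemma oracle_computable_const: "oracle_computable (\<lambda>p z. k)"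
proof (induction k)
  case 0
  show ?case unfolding oracle_computable_def by (meson eval.zero)
next
  case (Suc k)
  then show ?case by (rule oracle_computable_Suc)
qed

section \<open>Closure under primitive recursion, case distinction and arithmetic\<close>

lemma oracle_computable_rec_nat:
  assumes "oracle_computable f" "oracle_computable h" "oracle_computable k"
  shows "oracle_computable
    (\<lambda>p z. rec_nat (f p z) (\<lambda>n u. h p (prod_encode (z, prod_encode (n, u)))) (k p z))"
proof -
  obtain a b where a: "\<And>p z. eval p a z (f p z)" and b: "\<And>p z. eval p b z (h p z)"
    using assms(1,2) unfolding oracle_computable_def by meson
  have "eval p (CPrec a b) (prod_encode (z, n))
      (rec_nat (f p z) (\<lambda>n u. h p (prod_encode (z, prod_encode (n, u)))) n)" for p z n
  proof (induction n)
    case 0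
    show ?case using eval.prec_0[OF a] by simp
  next
    case (Suc n)
    show ?case using eval.prec_Suc[OF Suc b] by simp
  qed
  then have "oracle_computable (\<lambda>p s. rec_nat (f p (fst (prod_decode s)))
      (\<lambda>n u. h p (prod_encode (fst (prod_decode s), prod_encode (n, u)))) (snd (prod_decode s)))"
    unfolding oracle_computable_def by (metis prod.collapse prod_decode_inverse)
  \<comment> \<open>\<open>CPrec\<close> takes the parameter and the counter as one pair; feeding it
    \<open>(z, k p z)\<close> lets the recursion depth depend on \<open>z\<close>.\<close>
  from oracle_computable_compose[OF this oracle_computable_pair[OF oracle_computable_id assms(3)]]
  show ?thesis by simp
qed

text \<open>A recursion along \<open>k p z\<close> whose step ignores the previous value: any
  positive depth yields \<open>g\<close>, depth 0 yields \<open>f\<close>.\<close>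

lemma oracle_computable_if_zero:
  assumes "oracle_computable k" "oracle_computable f" "oracle_computable g"
  shows "oracle_computable (\<lambda>p z. if k p z = 0 then f p z else g p z)"
proof -
  have "oracle_computable (\<lambda>p s. g p (fst (prod_decode s)))"
    by (intro oracle_computable_compose[OF assms(3)] oracle_computable_fst oracle_computable_id)
  from oracle_computable_rec_nat[OF assms(2) this assms(1)]
  have "oracle_computable (\<lambda>p z. rec_nat (f p z) (\<lambda>n u. g p z) (k p z))" by simp
  moreover have "rec_nat u (\<lambda>n u. v) n = (if n = 0 then u else v)" for u v n :: nat
    by (cases n) auto
  ultimately show ?thesis by simp
qed

lemma oracle_computable_add:
  assumes "oracle_computable f" "oracle_computable g"
  shows "oracle_computable (\<lambda>p z. f p z + g p z)"
proof -
  have "oracle_computable (\<lambda>p s. Suc (snd (prod_decode (snd (prod_decode s)))))"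
    by (intro oracle_computable_Suc oracle_computable_snd oracle_computable_id)
  from oracle_computable_rec_nat[OF assms(1) this assms(2)]
  have "oracle_computable (\<lambda>p z. rec_nat (f p z) (\<lambda>n u. Suc u) (g p z))" by simp
  moreover have "rec_nat u (\<lambda>n u. Suc u) n = u + n" for u n :: nat
    by (induction n) auto
  ultimately show ?thesis by simp
qed

text \<open>Truncated subtraction is the iterated predecessor, and the predecessor is the recursion
  whose step returns its own counter.\<close>

lemma oracle_computable_diff:
  assumes "oracle_computable f" "oracle_computable g"
  shows "oracle_computable (\<lambda>p z. f p z - g p z)"
proof -
  have "oracle_computable (\<lambda>p s. fst (prod_decode (snd (prod_decode s))))"
    by (intro oracle_computable_fst oracle_computable_snd oracle_computable_id)
  from oracle_computable_rec_nat[OF oracle_computable_const[of 0] this oracle_computable_id]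
  have "oracle_computable (\<lambda>p z. rec_nat 0 (\<lambda>n u. n) z)" by simp
  moreover have "rec_nat 0 (\<lambda>n u. n) n = n - 1" for n :: nat
    by (cases n) auto
  ultimately have pred: "oracle_computable (\<lambda>p z. z - 1)" by simp
  have "oracle_computable (\<lambda>p s. snd (prod_decode (snd (prod_decode s))) - 1)"
    by (intro oracle_computable_compose[OF pred] oracle_computable_snd oracle_computable_id)
  from oracle_computable_rec_nat[OF assms(1) this assms(2)]
  have "oracle_computable (\<lambda>p z. rec_nat (f p z) (\<lambda>n u. u - 1) (g p z))" by simp
  moreover have "rec_nat u (\<lambda>n u. u - 1) n = u - n" for u n :: nat
    by (induction n) auto
  ultimately show ?thesis by simp
qed

lemma oracle_computable_mult_const:
  assumes "oracle_computable f"
  shows "oracle_computable (\<lambda>p z. k * f p z)"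
proof (induction k)
  case 0
  show ?case using oracle_computable_const[of 0] by simp
next
  case (Suc k)
  from oracle_computable_add[OF assms this] show ?case by simp
qed

lemmas oracle_computable_intros =
  oracle_computable_pair oracle_computable_id oracle_computable_Suc oracle_computable_fst
  oracle_computable_snd oracle_computable_query oracle_computable_const
  oracle_computable_if_zero oracle_computable_add oracle_computable_diff
  oracle_computable_mult_const

lemma join_even [simp]: "join p q (2 * n) = p n"
  by (simp add: join_def)

lemma join_odd [simp]: "join p q (Suc (2 * n)) = q n"
  by (simp add: join_def)

section \<open>Tables of computations\<close>

text \<open>
  A table \<open>w\<close> lists claimed values: \<open>0\<close> stands for divergence and \<open>Suc v\<close> for the value \<open>v\<close>.
  Besides the value of code \<open>e\<close> on input \<open>n\<close> it lists the result of the unbounded search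
  for a zero of \<open>\<lambda>j. e (y, j)\<close> that starts at \<open>j = n\<close>; thus no bounded quantifier is needed in the
  local condition for \<^const>\<open>CMu\<close>.
\<close>

definition table_val :: "baire \<Rightarrow> nat \<Rightarrow> nat \<Rightarrow> nat" where
  "table_val w e n = w (prod_encode (0, prod_encode (e, n)))"

definition table_search :: "baire \<Rightarrow> nat \<Rightarrow> nat \<Rightarrow> nat \<Rightarrow> nat" where
  "table_search w e y n = w (prod_encode (1, prod_encode (e, prod_encode (y, n))))"

text \<open>Absolute difference, written with truncated subtraction. Sums of such terms turn a
  conjunction of equations into one numerical test.\<close>

definition separation :: "nat \<Rightarrow> nat \<Rightarrow> nat" where
  "separation u v = (u - v) + (v - u)"

lemma separation_eq_0 [simp]: "separation u v = 0 \<longleftrightarrow> u = v"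
  by (auto simp: separation_def)

text \<open>
  The oracle of the tabulated computations is \<open>join p g\<close>, where \<open>g\<close> is read off the table
  itself: the only requirement on the odd oracle queries is that they have a value.
\<close>

definition table_defect :: "baire \<Rightarrow> baire \<Rightarrow> nat \<Rightarrow> nat \<Rightarrow> nat \<Rightarrow> nat \<Rightarrow> nat" where
  "table_defect p w a b y n =
     separation (table_val w 0 n) (Suc 0) +
     separation (table_val w 1 n) (Suc (Suc n)) +
     separation (table_val w 2 n) (Suc (fst (prod_decode n))) +
     separation (table_val w 3 n) (Suc (snd (prod_decode n))) +
     separation (table_val w 4 (2 * n)) (Suc (p n)) +
     (1 - table_val w 4 (Suc (2 * n))) +
     separation (table_val w (5 + 4 * prod_encode (a, b)) n)
       (if table_val w a n = 0 then 0 else if table_val w b n = 0 then 0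
        else Suc (prod_encode (table_val w a n - 1, table_val w b n - 1))) +
     separation (table_val w (6 + 4 * prod_encode (a, b)) n)
       (if table_val w b n = 0 then 0 else table_val w a (table_val w b n - 1)) +
     separation (table_val w (7 + 4 * prod_encode (a, b)) (prod_encode (y, 0))) (table_val w a y) +
     separation (table_val w (7 + 4 * prod_encode (a, b)) (prod_encode (y, Suc n)))
       (if table_val w (7 + 4 * prod_encode (a, b)) (prod_encode (y, n)) = 0 then 0
        else table_val w b (prod_encode (y, prod_encode (n,
               table_val w (7 + 4 * prod_encode (a, b)) (prod_encode (y, n)) - 1)))) +
     separation (table_val w (8 + 4 * a) y) (table_search w a y 0) +
     separation (table_search w a y n)
       (if table_val w a (prod_encode (y, n)) = 0 then 0
        else if table_val w a (prod_encode (y, n)) - 1 = 0 then Suc n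
        else table_search w a y (Suc n))"

lemma table_defect_eq_0:
  "table_defect p w a b y n = 0 \<longleftrightarrow>
     table_val w 0 n = Suc 0 \<and>
     table_val w 1 n = Suc (Suc n) \<and>
     table_val w 2 n = Suc (fst (prod_decode n)) \<and>
     table_val w 3 n = Suc (snd (prod_decode n)) \<and>
     table_val w 4 (2 * n) = Suc (p n) \<and>
     table_val w 4 (Suc (2 * n)) \<noteq> 0 \<and>
     table_val w (5 + 4 * prod_encode (a, b)) n =
       (if table_val w a n = 0 then 0 else if table_val w b n = 0 then 0
        else Suc (prod_encode (table_val w a n - 1, table_val w b n - 1))) \<and>
     table_val w (6 + 4 * prod_encode (a, b)) n =
       (if table_val w b n = 0 then 0 else table_val w a (table_val w b n - 1)) \<and>
     table_val w (7 + 4 * prod_encode (a, b)) (prod_encode (y, 0)) = table_val w a y \<and>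
     table_val w (7 + 4 * prod_encode (a, b)) (prod_encode (y, Suc n)) =
       (if table_val w (7 + 4 * prod_encode (a, b)) (prod_encode (y, n)) = 0 then 0
        else table_val w b (prod_encode (y, prod_encode (n,
               table_val w (7 + 4 * prod_encode (a, b)) (prod_encode (y, n)) - 1)))) \<and>
     table_val w (8 + 4 * a) y = table_search w a y 0 \<and>
     table_search w a y n =
       (if table_val w a (prod_encode (y, n)) = 0 then 0
        else if table_val w a (prod_encode (y, n)) - 1 = 0 then Suc n
        else table_search w a y (Suc n))"
proof -
  have "1 - m = 0 \<longleftrightarrow> m \<noteq> 0" for m :: nat by auto
  then show ?thesis
    unfolding table_defect_def add_is_0 separation_eq_0 by (simp only: conj_assoc)
qed

text \<open>Induction on the evaluation: each schema is matched by a local equation of the table,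
  and the induction hypotheses exclude its divergence branches. So an entry 0 can only belong to a
  computation that diverges.\<close>

lemma table_complete:
  assumes "\<And>a b y n. table_defect p w a b y n = 0"
    and "eval (join p (\<lambda>n. table_val w 4 (Suc (2 * n)) - 1)) c n v"
  shows "table_val w (encode c) n = Suc v"
proof -
  note eqs = assms(1)[unfolded table_defect_eq_0]
  have atoms: "table_val w 0 n = Suc 0" "table_val w 1 n = Suc (Suc n)"
    "table_val w 2 n = Suc (fst (prod_decode n))" "table_val w 3 n = Suc (snd (prod_decode n))"
    "table_val w 4 (2 * n) = Suc (p n)" "table_val w 4 (Suc (2 * n)) \<noteq> 0" for n
    by (insert eqs[of n 0 0 0]) (elim conjE, assumption)+
  \<comment> \<open>For odd queries the subtraction of 1 is undone because the table has no entry 0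
    there.\<close>
  have queries: "table_val w 4 x = Suc (join p (\<lambda>n. table_val w 4 (Suc (2 * n)) - 1) x)" for x
  proof (cases "even x")
    case True
    then obtain k where "x = 2 * k" ..
    then show ?thesis using atoms by simp
  next
    case False
    then obtain k where "x = Suc (2 * k)" by (auto elim: oddE)
    then show ?thesis using atoms by simp
  qed
  from assms(2) show ?thesis
  proof (induction rule: eval.induct)
    case (zero x)
    show ?case using atoms by simp
  next
    case (succ x)
    show ?case using atoms by simp
  next
    case (fst x)
    show ?case using atoms by simp
  next
    case (snd x)
    show ?case using atoms by simp
  next
    case (query x)
    show ?case unfolding encode.simps by (rule queries)
  next
    case (pair a x u b v)
    have "table_val w (encode (CPair a b)) x =
       (if table_val w (encode a) x = 0 then 0 else if table_val w (encode b) x = 0 then 0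
        else Suc (prod_encode (table_val w (encode a) x - 1, table_val w (encode b) x - 1)))"
      using eqs[of x "encode a" "encode b" 0] unfolding encode.simps by (elim conjE)
    with pair.IH show ?case by simp
  next
    case (comp b x u a v)
    have "table_val w (encode (CComp a b)) x =
       (if table_val w (encode b) x = 0 then 0
        else table_val w (encode a) (table_val w (encode b) x - 1))"
      using eqs[of x "encode a" "encode b" 0] unfolding encode.simps by (elim conjE)
    with comp.IH show ?case by simp
  next
    case (prec_0 a x v b)
    have "table_val w (encode (CPrec a b)) (prod_encode (x, 0)) = table_val w (encode a) x"
      using eqs[of 0 "encode a" "encode b" x] unfolding encode.simps by (elim conjE)
    with prec_0.IH show ?case by simp
  next
    case (prec_Suc a b x n u v)
    have "table_val w (encode (CPrec a b)) (prod_encode (x, Suc n)) =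
       (if table_val w (encode (CPrec a b)) (prod_encode (x, n)) = 0 then 0
        else table_val w (encode b) (prod_encode (x, prod_encode (n,
               table_val w (encode (CPrec a b)) (prod_encode (x, n)) - 1))))"
      using eqs[of n "encode a" "encode b" x] unfolding encode.simps by (elim conjE)
    with prec_Suc.IH show ?case by simp
  next
    case (mu a x n)
    have search: "table_search w (encode a) x k =
       (if table_val w (encode a) (prod_encode (x, k)) = 0 then 0
        else if table_val w (encode a) (prod_encode (x, k)) - 1 = 0 then Suc k
        else table_search w (encode a) x (Suc k))" for k
      using eqs[of k "encode a" 0 x] by (elim conjE)
    \<comment> \<open>Backwards from the zero at \<open>n\<close>: the entry there is
      \<open>Suc n\<close>, and each earlier position copies it from its successor.\<close>
    have "table_search w (encode a) x (n - i) = Suc n" if "i \<le> n" for i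
      using that
    proof (induction i)
      case 0
      show ?case using search[of n] mu.IH(1) by simp
    next
      case (Suc i)
      then have "table_search w (encode a) x (Suc (n - Suc i)) = Suc n"
        by (simp add: Suc_diff_Suc)
      moreover from Suc have "n - Suc i < n" by simp
      ultimately show ?case using search[of "n - Suc i"] mu.IH(2)[of "n - Suc i"] by auto
    qed
    from this[of n] have "table_search w (encode a) x 0 = Suc n" by simp
    moreover have "table_val w (encode (CMu a)) x = table_search w (encode a) x 0"
      using eqs[of 0 "encode a" 0 x] unfolding encode.simps by (elim conjE)
    ultimately show ?case by simp
  qed
qed

section \<open>The true table of an oracle computation\<close>

definition phi_nat :: "baire \<Rightarrow> nat \<Rightarrow> nat \<Rightarrow> nat" where
  "phi_nat q e n = (case phi e q n of None \<Rightarrow> 0 | Some v \<Rightarrow> Suc v)"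

lemma phi_nat_eq_Suc: "phi_nat q e n = Suc v \<longleftrightarrow> eval q (decode e) n v"
  by (auto simp: phi_nat_def phi_eq_Some[symmetric] split: option.split)

lemma phi_nat_eq_0: "phi_nat q e n = 0 \<longleftrightarrow> phi e q n = None"
  by (simp add: phi_nat_def split: option.split)

text \<open>Table entries agree once they record the same successful results; equations between
  entries thus become equivalences between evaluations.\<close>

lemma nat_eq_iff_Suc: "(\<And>v. m = Suc v \<longleftrightarrow> n = Suc v) \<Longrightarrow> m = n"
  by (metis old.nat.exhaust)

lemma eval_CPrec_Suc:
  "eval p (CPrec a b) (prod_encode (x, Suc n)) v \<longleftrightarrow>
     (\<exists>u. eval p (CPrec a b) (prod_encode (x, n)) u \<and>
       eval p b (prod_encode (x, prod_encode (n, u))) v)"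
proof
  assume "eval p (CPrec a b) (prod_encode (x, Suc n)) v"
  then show "\<exists>u. eval p (CPrec a b) (prod_encode (x, n)) u \<and>
      eval p b (prod_encode (x, prod_encode (n, u))) v"
    by (rule eval_precE) auto
qed (auto intro: eval.prec_Suc)

lemma decode_CPair: "decode (5 + 4 * prod_encode (a, b)) = CPair (decode a) (decode b)"
  by (metis decode_def decode_encode encode.simps(6) surj_encode surj_f_inv_f)

lemma decode_CComp: "decode (6 + 4 * prod_encode (a, b)) = CComp (decode a) (decode b)"
  by (metis decode_def decode_encode encode.simps(7) surj_encode surj_f_inv_f)

lemma decode_CPrec: "decode (7 + 4 * prod_encode (a, b)) = CPrec (decode a) (decode b)"
  by (metis decode_def decode_encode encode.simps(8) surj_encode surj_f_inv_f)

lemma decode_CMu: "decode (8 + 4 * a) = CMu (decode a)"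
  by (metis decode_def decode_encode encode.simps(9) surj_encode surj_f_inv_f)

lemma decode_atom:
  "decode 0 = CZero" "decode 1 = CSucc" "decode 2 = CFst" "decode 3 = CSnd" "decode 4 = COracle"
  by (metis decode_encode encode.simps)+

text \<open>The graph of the search that \<open>table_search\<close> tabulates; for
  \<open>n = 0\<close> it is the graph of \<open>CMu\<close>.\<close>

definition finds_zero :: "baire \<Rightarrow> nat \<Rightarrow> nat \<Rightarrow> nat \<Rightarrow> nat \<Rightarrow> bool" where
  "finds_zero q e y n j \<longleftrightarrow> n \<le> j \<and> eval q (decode e) (prod_encode (y, j)) 0 \<and>
     (\<forall>i\<in>{n..<j}. \<exists>v. eval q (decode e) (prod_encode (y, i)) (Suc v))"

lemma finds_zero_unique:
  assumes "finds_zero q e y n j" "finds_zero q e y n k"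
  shows "j = k"
proof (rule ccontr)
  assume "j \<noteq> k"
  then consider "j < k" | "k < j" by linarith
  then show False
    by cases (use assms in \<open>auto simp: finds_zero_def dest: eval_det\<close>; fastforce dest: eval_det)+
qed

lemma finds_zero_0: "finds_zero q e y 0 j \<longleftrightarrow> eval q (CMu (decode e)) y j"
  by (auto simp: finds_zero_def intro: eval.mu elim: eval_muE)

text \<open>A value 0 stops the search, a positive value passes it on, and divergence blocks it:
  these are the three branches of the last condition in \<open>table_defect\<close>.\<close>

lemma finds_zero_step:
  "finds_zero q e y n j \<longleftrightarrow>
     eval q (decode e) (prod_encode (y, n)) 0 \<and> j = n \<or>
     (\<exists>v. eval q (decode e) (prod_encode (y, n)) (Suc v)) \<and> finds_zero q e y (Suc n) j"
proof (cases "n = j")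
  case True
  then show ?thesis by (auto simp: finds_zero_def)
next
  case False
  then have "n \<le> j \<longleftrightarrow> Suc n \<le> j" by auto
  moreover have "{n..<j} = insert n {Suc n..<j}" if "Suc n \<le> j"
    using that by auto
  ultimately show ?thesis using False by (auto simp: finds_zero_def)
qed

definition search_nat :: "baire \<Rightarrow> nat \<Rightarrow> nat \<Rightarrow> nat \<Rightarrow> nat" where
  "search_nat q e y n =
     (if \<exists>j. finds_zero q e y n j then Suc (THE j. finds_zero q e y n j) else 0)"

lemma search_nat_eq_Suc: "search_nat q e y n = Suc j \<longleftrightarrow> finds_zero q e y n j"
proof -
  have "(THE j. finds_zero q e y n j) = j" if "finds_zero q e y n j" for j
    using that by (rule the_equality) (rule finds_zero_unique[OF _ that])
  then show ?thesis by (auto simp: search_nat_def)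
qed

definition phi_table :: "baire \<Rightarrow> baire" where
  "phi_table q s = (case prod_decode s of (i, t) \<Rightarrow> case prod_decode t of (e, r) \<Rightarrow>
     if i = 0 then phi_nat q e r
     else case prod_decode r of (y, n) \<Rightarrow> search_nat q e y n)"

lemma table_val_phi_table [simp]: "table_val (phi_table q) = phi_nat q"
  by (intro ext) (simp add: table_val_def phi_table_def)

lemma table_search_phi_table [simp]: "table_search (phi_table q) = search_nat q"
  by (intro ext) (simp add: table_search_def phi_table_def)

text \<open>Each local equation is a schema read in both directions, by its introduction rule and by
  inversion. The table serves as a witness for the function quantifier.\<close>

lemma table_defect_phi_table: "table_defect p (phi_table (join p g)) a b y n = 0"
proof -
  let ?q = "join p g"
  have "phi_nat ?q 0 n = Suc 0"
    by (simp add: phi_nat_eq_Suc decode_atom eval.zero)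
  moreover have "phi_nat ?q 1 n = Suc (Suc n)"
    unfolding phi_nat_eq_Suc decode_atom by (rule eval.succ)
  moreover have "phi_nat ?q 2 n = Suc (fst (prod_decode n))"
    by (simp add: phi_nat_eq_Suc decode_atom eval.fst)
  moreover have "phi_nat ?q 3 n = Suc (snd (prod_decode n))"
    by (simp add: phi_nat_eq_Suc decode_atom eval.snd)
  moreover have query: "phi_nat ?q 4 i = Suc (?q i)" for i
    by (simp add: phi_nat_eq_Suc decode_atom eval.query)
  moreover have "phi_nat ?q 4 (2 * n) = Suc (p n)" "phi_nat ?q 4 (Suc (2 * n)) \<noteq> 0"
    by (simp_all add: query)
  moreover have "phi_nat ?q (5 + 4 * prod_encode (a, b)) n =
      (if phi_nat ?q a n = 0 then 0 else if phi_nat ?q b n = 0 then 0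
       else Suc (prod_encode (phi_nat ?q a n - 1, phi_nat ?q b n - 1)))"
  proof (rule nat_eq_iff_Suc)
    fix v
    have "phi_nat ?q (5 + 4 * prod_encode (a, b)) n = Suc v \<longleftrightarrow>
        (\<exists>r s. phi_nat ?q a n = Suc r \<and> phi_nat ?q b n = Suc s \<and> v = prod_encode (r, s))"
      unfolding phi_nat_eq_Suc decode_CPair by (auto elim: eval_pairE intro: eval.pair)
    then show "phi_nat ?q (5 + 4 * prod_encode (a, b)) n = Suc v \<longleftrightarrow>
      (if phi_nat ?q a n = 0 then 0 else if phi_nat ?q b n = 0 then 0
       else Suc (prod_encode (phi_nat ?q a n - 1, phi_nat ?q b n - 1))) = Suc v"
      by (cases "phi_nat ?q a n"; cases "phi_nat ?q b n") auto
  qed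
  moreover have "phi_nat ?q (6 + 4 * prod_encode (a, b)) n =
      (if phi_nat ?q b n = 0 then 0 else phi_nat ?q a (phi_nat ?q b n - 1))"
  proof (rule nat_eq_iff_Suc)
    fix v
    have "phi_nat ?q (6 + 4 * prod_encode (a, b)) n = Suc v \<longleftrightarrow>
        (\<exists>u. phi_nat ?q b n = Suc u \<and> phi_nat ?q a u = Suc v)"
      unfolding phi_nat_eq_Suc decode_CComp by (auto elim: eval_compE intro: eval.comp)
    then show "phi_nat ?q (6 + 4 * prod_encode (a, b)) n = Suc v \<longleftrightarrow>
      (if phi_nat ?q b n = 0 then 0 else phi_nat ?q a (phi_nat ?q b n - 1)) = Suc v"
      by (cases "phi_nat ?q b n") auto
  qed
  moreover have "phi_nat ?q (7 + 4 * prod_encode (a, b)) (prod_encode (y, 0)) = phi_nat ?q a y"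
    by (rule nat_eq_iff_Suc, unfold phi_nat_eq_Suc decode_CPrec)
      (auto elim: eval_precE intro: eval.prec_0)
  moreover have "phi_nat ?q (7 + 4 * prod_encode (a, b)) (prod_encode (y, Suc n)) =
      (if phi_nat ?q (7 + 4 * prod_encode (a, b)) (prod_encode (y, n)) = 0 then 0
       else phi_nat ?q b (prod_encode (y, prod_encode (n,
              phi_nat ?q (7 + 4 * prod_encode (a, b)) (prod_encode (y, n)) - 1))))"
    (is "?l = ?r")
  proof (rule nat_eq_iff_Suc)
    fix v
    have "?l = Suc v \<longleftrightarrow>
        (\<exists>u. phi_nat ?q (7 + 4 * prod_encode (a, b)) (prod_encode (y, n)) = Suc u \<and>
          phi_nat ?q b (prod_encode (y, prod_encode (n, u))) = Suc v)"
      unfolding phi_nat_eq_Suc decode_CPrec by (rule eval_CPrec_Suc)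
    then show "?l = Suc v \<longleftrightarrow> ?r = Suc v"
      by (cases "phi_nat ?q (7 + 4 * prod_encode (a, b)) (prod_encode (y, n))") auto
  qed
  moreover have "phi_nat ?q (8 + 4 * a) y = search_nat ?q a y 0"
    by (rule nat_eq_iff_Suc)
      (simp only: phi_nat_eq_Suc search_nat_eq_Suc finds_zero_0 decode_CMu)
  moreover have "search_nat ?q a y n =
      (if phi_nat ?q a (prod_encode (y, n)) = 0 then 0
       else if phi_nat ?q a (prod_encode (y, n)) - 1 = 0 then Suc n
       else search_nat ?q a y (Suc n))" (is "_ = ?r")
  proof (rule nat_eq_iff_Suc)
    fix j
    have step: "search_nat ?q a y n = Suc j \<longleftrightarrow>
        phi_nat ?q a (prod_encode (y, n)) = Suc 0 \<and> j = n \<or>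
        (\<exists>v. phi_nat ?q a (prod_encode (y, n)) = Suc (Suc v)) \<and> search_nat ?q a y (Suc n) = Suc j"
      unfolding phi_nat_eq_Suc search_nat_eq_Suc by (rule finds_zero_step)
    show "search_nat ?q a y n = Suc j \<longleftrightarrow> ?r = Suc j"
    proof (cases "phi_nat ?q a (prod_encode (y, n))")
      case 0
      with step show ?thesis by simp
    next
      case (Suc m)
      with step show ?thesis by (cases m) auto
    qed
  qed
  ultimately show ?thesis
    unfolding table_defect_eq_0 table_val_phi_table table_search_phi_table by blast
qed

text \<open>From left to right, the true table for a diverging choice of \<open>g\<close> works.
  Conversely, \<open>g\<close> is read off the odd queries of \<open>w\<close>, and by
  \<open>table_complete\<close> the entry 0 forces divergence. What remains under the quantifier
  over \<open>w\<close> is a universal number quantifier over a computable condition.\<close>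

lemma not_in_Pi11_iff_table:
  "n \<notin> Pi11 e p \<longleftrightarrow> (\<exists>w. table_val w e n = 0 \<and> (\<forall>a b y i. table_defect p w a b y i = 0))"
proof
  assume "n \<notin> Pi11 e p"
  then obtain g where "phi e (join p g) n = None"
    by (auto simp: Pi11_def Sigma01_def)
  then have "table_val (phi_table (join p g)) e n = 0"
    by (simp add: phi_nat_eq_0)
  with table_defect_phi_table
  show "\<exists>w. table_val w e n = 0 \<and> (\<forall>a b y i. table_defect p w a b y i = 0)" by blast
next
  assume "\<exists>w. table_val w e n = 0 \<and> (\<forall>a b y i. table_defect p w a b y i = 0)"
  then obtain w where w: "table_val w e n = 0" "\<And>a b y i. table_defect p w a b y i = 0"
    by blast
  have "encode (decode e) = e"
    by (simp add: decode_def surj_encode surj_f_inv_f)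
  with w table_complete[OF w(2), of "decode e" n]
  have "phi e (join p (\<lambda>n. table_val w 4 (Suc (2 * n)) - 1)) n = None"
    by (metis nat.distinct(1) not_None_eq phi_eq_Some)
  then show "n \<notin> Pi11 e p"
    by (auto simp: Pi11_def Sigma01_def)
qed

section \<open>Membership\<close>

text \<open>
  The function variable \<open>g\<close> provides the tables \<open>\<lambda>s. g (m, s)\<close> for all \<open>m \<le> n\<close>; truncated
  subtraction makes \<open>n - i\<close> range over exactly these \<open>m\<close>.
\<close>

definition search_defect :: "baire \<Rightarrow> nat \<Rightarrow> nat \<Rightarrow> nat \<Rightarrow> nat \<Rightarrow> nat \<Rightarrow> nat \<Rightarrow> nat" where
  "search_defect q n i a b y j =
     table_val (\<lambda>s. q (Suc (2 * prod_encode (n - i, s)))) (q 0) (n - i) +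
     table_defect (\<lambda>k. q (2 * Suc k)) (\<lambda>s. q (Suc (2 * prod_encode (n - i, s)))) a b y j"

lemma oracle_computable_search_defect:
  assumes "oracle_computable n" "oracle_computable i" "oracle_computable a"
    "oracle_computable b" "oracle_computable y" "oracle_computable j"
  shows "oracle_computable
    (\<lambda>p z. search_defect p (n p z) (i p z) (a p z) (b p z) (y p z) (j p z))"
  unfolding search_defect_def table_defect_def table_val_def table_search_def separation_def
  by (intro oracle_computable_intros assms)

text \<open>Closure of \<Pi>-1-1 under bounded existential quantification: in the complement,
  finitely many tables are merged into one function. The index may vary with the name since a table
  covers all codes.\<close>

lemma uniformly_Pi11_bounded_Ex:
  "uniformly_Pi11 (\<lambda>n. {x. \<exists>m\<le>n. m \<in> Pi11 (x 0) (\<lambda>k. x (Suc k))})"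
proof -
  \<comment> \<open>Truncated subtraction from 1 swaps zero and nonzero, so the search by
    \<open>CMu\<close> halts exactly when it meets a defect.\<close>
  define F where "F q z = (case prod_decode z of (n, t) \<Rightarrow> case prod_decode t of (i, t) \<Rightarrow>
    case prod_decode t of (a, t) \<Rightarrow> case prod_decode t of (b, t) \<Rightarrow>
    case prod_decode t of (y, j) \<Rightarrow> 1 - search_defect q n i a b y j)" for q z
  have "oracle_computable F"
    unfolding F_def case_prod_beta
    by (intro oracle_computable_intros oracle_computable_search_defect)
  then obtain c where c: "\<And>q z. eval q c z (F q z)"
    unfolding oracle_computable_def by blast
  have eval_c: "eval q c z v \<longleftrightarrow> v = F q z" for q z v
    using c eval_det by blast
  have halts: "(\<exists>v. eval q (CMu c) n v) \<longleftrightarrow> (\<exists>i a b y j. search_defect q n i a b y j \<noteq> 0)"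
    (is "?l \<longleftrightarrow> ?r") for q n
  proof
    assume ?l
    then obtain t where "F q (prod_encode (n, t)) = 0"
      by (auto simp: eval_c elim: eval_muE)
    moreover obtain i a b y j
      where "t = prod_encode (i, prod_encode (a, prod_encode (b, prod_encode (y, j))))"
      by (metis prod_decode_inverse surj_pair)
    ultimately have "search_defect q n i a b y j \<noteq> 0"
      by (simp add: F_def)
    then show ?r by blast
  next
    assume ?r
    then obtain i a b y j where "search_defect q n i a b y j \<noteq> 0" by blast
    then have "F q (prod_encode (n,
        prod_encode (i, prod_encode (a, prod_encode (b, prod_encode (y, j)))))) = 0"
      by (simp add: F_def)
    then have ex: "\<exists>t. F q (prod_encode (n, t)) = 0" ..
    \<comment> \<open>\<open>CMu\<close> demands positive values before the zero it returns, hence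
      the least zero; \<open>c\<close> has a value everywhere.\<close>
    let ?t = "LEAST t. F q (prod_encode (n, t)) = 0"
    have "eval q (CMu c) n ?t"
    proof (rule eval.mu)
      show "eval q c (prod_encode (n, ?t)) 0"
        using LeastI_ex[OF ex] by (simp add: eval_c)
      show "\<exists>v. eval q c (prod_encode (n, s)) (Suc v)" if "s < ?t" for s
        using not_less_Least[OF that] c[of q] by (metis not0_implies_Suc)
    qed
    then show ?l ..
  qed
  have "n \<notin> Pi11 (encode (CMu c)) x \<longleftrightarrow> (\<forall>m\<le>n. m \<notin> Pi11 (x 0) (\<lambda>k. x (Suc k)))" for n x
  proof -
    define ok where "ok w m \<longleftrightarrow> table_val w (x 0) m = 0 \<and>
      (\<forall>a b y j. table_defect (\<lambda>k. x (Suc k)) w a b y j = 0)" for w m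
    \<comment> \<open>In the joined oracle the index of the name stays at position 0, its parameter
      occupies the even positions from 2 on, and \<open>g\<close> the odd ones.\<close>
    have x_0: "join x g 0 = x 0" for g
      by (simp add: join_def)
    have "n \<notin> Pi11 (encode (CMu c)) x \<longleftrightarrow> (\<exists>g. \<not> (\<exists>v. eval (join x g) (CMu c) n v))"
      by (simp add: Pi11_def Sigma01_def phi_eq_Some del: encode.simps)
    also have "\<dots> \<longleftrightarrow> (\<exists>g. \<forall>i. ok (\<lambda>s. g (prod_encode (n - i, s))) (n - i))"
      unfolding halts search_defect_def ok_def join_even join_odd x_0 by simp
    also have "\<dots> \<longleftrightarrow> (\<exists>g. \<forall>m\<le>n. ok (\<lambda>s. g (prod_encode (m, s))) m)"
    proof -
      have "(\<forall>i. Q (n - i)) \<longleftrightarrow> (\<forall>m\<le>n. Q m)" for Q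
        by (metis diff_diff_cancel diff_le_self)
      from this[of "\<lambda>m. ok (\<lambda>s. _ (prod_encode (m, s))) m"] show ?thesis by simp
    qed
    also have "\<dots> \<longleftrightarrow> (\<forall>m\<le>n. \<exists>w. ok w m)"
    proof
      assume "\<forall>m\<le>n. \<exists>w. ok w m"
      then obtain W where "\<forall>m\<le>n. ok (W m) m" by metis
      \<comment> \<open>The tables \<open>W m\<close> are packed into one function. Decoding is left
        unreduced so that this is literally the instance for the witness below.\<close>
      then have "\<forall>m\<le>n. ok (\<lambda>s. (case prod_decode (prod_encode (m, s)) of (m, s) \<Rightarrow> W m s)) m"
        by simp
      then show "\<exists>g. \<forall>m\<le>n. ok (\<lambda>s. g (prod_encode (m, s))) m"
        by (rule exI[where x = "\<lambda>z. case prod_decode z of (m, s) \<Rightarrow> W m s"])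
    qed blast
    finally show ?thesis by (simp add: not_in_Pi11_iff_table ok_def del: encode.simps)
  qed
  then have "(\<exists>m\<le>n. m \<in> Pi11 (x 0) (\<lambda>k. x (Suc k))) \<longleftrightarrow> n \<in> Pi11 (encode (CMu c)) x" for n x
    by metis
  then show ?thesis
    unfolding uniformly_Pi11_def by (intro exI[of _ "encode (CMu c)"]) (simp del: encode.simps)
qed

section \<open>The least number principle as an increasing difference\<close>

lemma computable_seq_index: "computable_seq (\<lambda>n x. Some n)"
proof -
  obtain c where "\<And>p n. eval p c n n"
    using oracle_computable_id unfolding oracle_computable_def by blast
  then have "\<And>p n. phi (encode c) p n = Some n"
    by (simp add: phi_eq_Some)
  then show ?thesis
    unfolding computable_seq_def by metis
qed

text \<open>The first stage \<open>n\<close> at which a name enters \<open>A\<close> is the minimum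
  of the set it names, so it suffices that the \<open>n\<close>-th function returns
  \<open>n\<close>.\<close>

lemma Pi11_LNP_in_up_D_omega: "Pi11_LNP \<circ>\<^sub>m rep_Pi11 \<in> up_D_omega"
proof -
  define A where "A n = {x. \<exists>m\<le>n. m \<in> Pi11 (x 0) (\<lambda>k. x (Suc k))}" for n
  have "(Pi11_LNP \<circ>\<^sub>m rep_Pi11) x = up_diff (\<lambda>n x. Some n) A x" for x
  proof (cases "Pi11 (x 0) (\<lambda>k. x (Suc k)) = {}")
    case True
    then show ?thesis
      by (simp add: map_comp_def rep_Pi11_def Pi11_LNP_def up_diff_def A_def)
  next
    case False
    let ?B = "Pi11 (x 0) (\<lambda>k. x (Suc k))"
    have "(LEAST n. x \<in> A n) = (LEAST n. n \<in> ?B)"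
    proof (rule Least_equality)
      show "x \<in> A (LEAST n. n \<in> ?B)"
        using LeastI_ex[of "\<lambda>n. n \<in> ?B"] False unfolding A_def by blast
      show "(LEAST n. n \<in> ?B) \<le> n" if "x \<in> A n" for n
        using that unfolding A_def by (blast intro: Least_le le_trans)
    qed
    moreover have "\<exists>n. x \<in> A n"
      using False unfolding A_def by blast
    ultimately show ?thesis
      using False by (simp add: map_comp_def rep_Pi11_def Pi11_LNP_def up_diff_def)
  qed
  then have "Pi11_LNP \<circ>\<^sub>m rep_Pi11 = up_diff (\<lambda>n x. Some n) A" ..
  moreover have "mono A"
    unfolding A_def by (rule monoI) (blast intro: le_trans)
  moreover have "uniformly_Pi11 A"
    using uniformly_Pi11_bounded_Ex unfolding A_def .
  ultimately show ?thesis
    unfolding up_D_omega_def using computable_seq_index by blast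
qed

section \<open>Hardness\<close>

primrec subst_oracle :: "code \<Rightarrow> code \<Rightarrow> code" where
  "subst_oracle d CZero = CZero"
| "subst_oracle d CSucc = CSucc"
| "subst_oracle d CFst = CFst"
| "subst_oracle d CSnd = CSnd"
| "subst_oracle d COracle = d"
| "subst_oracle d (CPair a b) = CPair (subst_oracle d a) (subst_oracle d b)"
| "subst_oracle d (CComp a b) = CComp (subst_oracle d a) (subst_oracle d b)"
| "subst_oracle d (CPrec a b) = CPrec (subst_oracle d a) (subst_oracle d b)"
| "subst_oracle d (CMu a) = CMu (subst_oracle d a)"

text \<open>Every query to \<open>q\<close> is answered by running \<open>d\<close> relative to
  \<open>p\<close>; all other schemata are carried over unchanged.\<close>

lemma eval_subst_oracle:
  assumes d: "\<And>n. eval p d n (q n)" and "eval q c n v"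
  shows "eval p (subst_oracle d c) n v"
  using assms(2)
proof (induction rule: eval.induct)
  case (mu a x n)
  then show ?case by (auto intro!: eval.mu)
qed (auto intro: eval.intros d)

lemma computable_baire_total:
  assumes "oracle_computable F"
  shows "computable_baire (\<lambda>x. Some (F x))"
proof -
  obtain c where "\<And>p n. eval p c n (F p n)"
    using assms unfolding oracle_computable_def by blast
  then have "\<And>p n. phi (encode c) p n = Some (F p n)"
    by (simp add: phi_eq_Some)
  then show ?thesis
    unfolding computable_baire_def by (intro exI[of _ "encode c"]) simp
qed

text \<open>The minimum of \<open>Pi11 e x\<close> is the index of the branch that
  \<open>up_diff\<close> selects at \<open>x\<close>, so the backward functional only evaluates that
  member of the sequence \<open>f\<close> at \<open>x\<close>.\<close>

lemma up_D_omega_le_Pi11_LNP: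
  assumes "g \<in> up_D_omega"
  shows "weihrauch_le rep_baire rep_nat (\<lambda>x. set_option (g x))
    rep_Pi11 rep_nat (\<lambda>x. set_option (Pi11_LNP x))"
proof -
  from assms obtain f A where g: "g = up_diff f A" and "uniformly_Pi11 A" "computable_seq f"
    by (auto simp: up_D_omega_def)
  then obtain e e' where A: "\<And>n. A n = {x. n \<in> Pi11 e x}" and f: "\<And>n x. f n x = phi e' x n"
    unfolding uniformly_Pi11_def computable_seq_def by blast
  define h :: "baire \<Rightarrow> baire" where "h x n = (if n = 0 then e else x (n - 1))" for x n
  have "oracle_computable h"
    unfolding h_def by (intro oracle_computable_intros)
  then have h: "computable_baire (\<lambda>x. Some (h x))"
    by (rule computable_baire_total)
  have h_name: "rep_Pi11 (h x) = Some (Pi11 e x)" for x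
    by (simp add: rep_Pi11_def h_def)
  \<comment> \<open>On \<open>join x r\<close>, \<open>d\<close> recovers the input
    \<open>x\<close>, and \<open>a\<close> reads \<open>r 0\<close>, the number returned by the
    least number principle.\<close>
  have "oracle_computable (\<lambda>q n. q (2 * n))" "oracle_computable (\<lambda>q n. q (Suc 0))"
    by (intro oracle_computable_intros)+
  then obtain d a where d: "\<And>q n. eval q d n (q (2 * n))" and a: "\<And>q n. eval q a n (q (Suc 0))"
    unfolding oracle_computable_def by blast
  define c where "c = CComp (subst_oracle d (decode e')) a"
  \<comment> \<open>\<open>k\<close> gets the natural domain of \<open>c\<close>, as
    \<open>computable_baire\<close> demands. As \<open>c\<close> ignores its argument, the output is
    a constant sequence.\<close>
  define k where "k q = (if \<forall>n. phi (encode c) q n \<noteq> None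
    then Some (\<lambda>n. the (phi (encode c) q n)) else None)" for q
  have k: "computable_baire k"
    unfolding computable_baire_def k_def by blast
  have k_name: "k (join x r) = Some (\<lambda>n. v)" if "f (r 0) x = Some v" for x r v
  proof -
    have "eval x (decode e') (r 0) v"
      using that by (simp add: f phi_eq_Some)
    with d[of "join x r"] have "eval (join x r) (subst_oracle d (decode e')) (r 0) v"
      by (auto intro: eval_subst_oracle)
    with a[of "join x r"] have "eval (join x r) c n v" for n
      unfolding c_def using join_odd[of x r 0] by (auto intro: eval.comp)
    then have "phi (encode c) (join x r) n = Some v" for n
      by (simp add: phi_eq_Some del: encode.simps)
    then show ?thesis by (simp add: k_def)
  qed
  show ?thesis
    unfolding weihrauch_le_def
  proof (intro exI conjI allI impI)
    fix p x
    assume px: "rep_baire p = Some x \<and> set_option (g x) \<noteq> {}"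
    then have [simp]: "p = x" by (simp add: rep_baire_def)
    from px have "g x \<noteq> None" by simp
    \<comment> \<open>Outside the union of the \<open>A n\<close> the value of
      \<open>up_diff\<close> is \<open>None\<close>; a defined value therefore makes the named set
      inhabited.\<close>
    then have ne: "Pi11 e x \<noteq> {}"
      by (auto simp: g up_diff_def A split: if_splits)
    then have gx: "g x = f (LEAST n. n \<in> Pi11 e x) x"
      by (auto simp: g up_diff_def A)
    let ?v = "the (g x)"
    have v: "g x = Some ?v"
      using px by auto
    show "Some (h p) = Some (h p)" ..
    show "rep_Pi11 (h p) = Some (Pi11 e x)"
      by (simp add: h_name)
    show "set_option (Pi11_LNP (Pi11 e x)) \<noteq> {}"
      using ne by (simp add: Pi11_LNP_def)
    fix r u
    assume "rep_nat r = Some u \<and> u \<in> set_option (Pi11_LNP (Pi11 e x))"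
    with ne have r: "r 0 = (LEAST n. n \<in> Pi11 e x)"
      by (auto simp: rep_nat_def Pi11_LNP_def)
    from v have "f (r 0) x = Some ?v"
      using gx r by simp
    then show "k (join p r) = Some (\<lambda>n. ?v)"
      by (simp add: k_name)
    show "rep_nat (\<lambda>n. ?v) = Some ?v"
      by (simp add: rep_nat_def)
    show "?v \<in> set_option (g x)"
      using v by simp
  qed (fact h k)+
qed

theorem proposition3p4: "complete_for up_D_omega rep_Pi11 Pi11_LNP"
  unfolding complete_for_def
  using Pi11_LNP_in_up_D_omega up_D_omega_le_Pi11_LNP by blast

end
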